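(* The two-dimensional complex evolution algebras $E_1$ and $E_4$ with natural basis $\{e_1,e_2\}$ and multiplications $$E_1:\ e_1e_1=e_1,\qquad\qquad E_4:\ e_1e_1=e_2$$ (all products of basis elements not listed being zero) satisfy the condition $P$.
   Context: All algebras are finite dimensional over $\mathbb{C}$ (not necessarily associative). An evolution algebra is an algebra $E$ admitting a basis $\{e_1,\dots,e_n\}$ (called a natural basis) with $e_i\cdot e_j=0$ for $i\ne j$. A natural basis of $E$ is any vector space basis whose distinct elements multiply to zero. Condition $P$: an evolution algebra $E$ satisfies the condition $P$ if every subalgebra $M$ of $E$ (linear subspace closed under multiplication) has a basis consisting of elements with pairwise zero products (a natural basis of $M$) which can be extended to a natural basis of $E$. *)

theory Defs
  imports "HOL-Analysis.Analysis"
begin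

text \<open>
  Algebras are not assumed associative, commutative or unital. The underlying space is the whole
  type, with an arbitrary complex scalar multiplication on it.
\<close>

locale fd_complex_algebra = vector_space scale
  for scale :: "complex \<Rightarrow> 'a::ab_group_add \<Rightarrow> 'a" +
  fixes mult :: "'a \<Rightarrow> 'a \<Rightarrow> 'a"
  assumes linear_mult_left: "\<And>y. Vector_Spaces.linear scale scale (\<lambda>x. mult x y)"
    and linear_mult_right: "\<And>x. Vector_Spaces.linear scale scale (\<lambda>y. mult x y)"
    and finite_dimensional: "\<exists>B. finite B \<and> span B = UNIV"
begin

definition natural_basis :: "'a set \<Rightarrow> 'a set \<Rightarrow> bool" where
  "natural_basis M B \<longleftrightarrow>
     independent B \<and> span B = M \<and> pairwise (\<lambda>x y. mult x y = 0) B"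

definition evolution_algebra :: bool where
  "evolution_algebra \<longleftrightarrow> (\<exists>B. natural_basis UNIV B)"

definition subalgebra :: "'a set \<Rightarrow> bool" where
  "subalgebra M \<longleftrightarrow> subspace M \<and> (\<forall>x\<in>M. \<forall>y\<in>M. mult x y \<in> M)"

definition condition_P :: bool where
  "condition_P \<longleftrightarrow> evolution_algebra \<and>
     (\<forall>M. subalgebra M \<longrightarrow>
        (\<exists>B. natural_basis M B \<and> (\<exists>B'. B \<subseteq> B' \<and> natural_basis UNIV B')))"

end

text \<open>
  For every prescribed pair of squares there is a two-dimensional evolution algebra with natural
  basis \<open>{e\<^sub>1, e\<^sub>2}\<close> and those squares, so hypotheses of this form are satisfiable.
\<close>

lemma two_dim_evolution_algebra_exists:
  fixes a b c d :: complex
  defines "e1 \<equiv> axis 1 1 :: complex^2" and "e2 \<equiv> axis 2 1 :: complex^2"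
  shows "\<exists>mult. fd_complex_algebra (*s) mult \<and> e1 \<noteq> e2 \<and>
    fd_complex_algebra.natural_basis (*s) mult UNIV {e1, e2} \<and>
    mult e1 e1 = a *s e1 + b *s e2 \<and> mult e2 e2 = c *s e1 + d *s e2"
proof -
  define m :: "complex^2 \<Rightarrow> complex^2 \<Rightarrow> complex^2" where
    "m x y = (x$1 * y$1) *s (a *s e1 + b *s e2) + (x$2 * y$2) *s (c *s e1 + d *s e2)" for x y
  have ne: "e1 \<noteq> e2" by (simp add: e1_def e2_def axis_eq_axis)
  have cart: "{e1, e2} = (cart_basis :: (complex^2) set)"
    unfolding cart_basis_def e1_def e2_def by (auto simp: UNIV_2)
  have alg: "fd_complex_algebra (*s) m"
  proof
    show "m (x + x') y = m x y + m x' y" "m x (y + y') = m x y + m x y'"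
      "m (r *s x) y = r *s m x y" "m x (r *s y) = r *s m x y" for x x' y y' r
      by (simp_all add: m_def vec_eq_iff algebra_simps)
    show "\<exists>B. finite B \<and> vec.span B = (UNIV :: (complex^2) set)"
      using span_cart_basis finite_cart_basis by blast
  qed
  interpret fd_complex_algebra "(*s)" m by (rule alg)
  have "pairwise (\<lambda>x y. m x y = 0) {e1, e2}"
    by (auto simp: pairwise_def m_def e1_def e2_def axis_def)
  then have "natural_basis UNIV {e1, e2}"
    using independent_cart_basis span_cart_basis by (simp add: natural_basis_def cart)
  then show ?thesis
    using alg ne by (intro exI[of _ m]) (simp add: m_def e1_def e2_def axis_def)
qed

end

theory Submission
  imports Defs
begin

text \<open>
  In both algebras the square of \<open>v = a e\<^sub>1 + b e\<^sub>2\<close> is \<open>a\<^sup>2 w\<close> for a vector \<open>w\<close> that is itself a member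
  of the natural basis: \<open>w = e\<^sub>1\<close> for the first algebra and \<open>w = e\<^sub>2\<close> for the second. Hence a
  subalgebra containing some \<open>v\<close> with \<open>a \<noteq> 0\<close> contains \<open>w\<close>, and subtracting from \<open>v\<close> its component
  along \<open>w\<close> isolates the other component. So a subalgebra contains each of the components
  \<open>a e\<^sub>1\<close> and \<open>b e\<^sub>2\<close> of its elements, and is spanned by the vectors among \<open>e\<^sub>1, e\<^sub>2\<close> that lie in it
  (\<open>subalgebra_coordinate\<close>).

  This is enough for the condition P: a subset of the natural basis \<open>{e\<^sub>1, e\<^sub>2}\<close> is a natural basis
  of its span, and it extends to \<open>{e\<^sub>1, e\<^sub>2}\<close> (\<open>condition_P_if_coordinate\<close>).
\<close>

context fd_complex_algebra
begin

lemma natural_basis_subset: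
  assumes "natural_basis M B" and "C \<subseteq> B"
  shows "natural_basis (span C) C"
  using assms independent_mono pairwise_subset unfolding natural_basis_def by blast

text \<open>
  A sufficient criterion for the condition P in any dimension: a single natural basis of the algebra
  serves as the extension for every subalgebra at once.
\<close>

lemma condition_P_if_coordinate:
  assumes N: "natural_basis UNIV N"
    and coordinate: "\<And>M. subalgebra M \<Longrightarrow> M \<subseteq> span (M \<inter> N)"
  shows "condition_P"
  unfolding condition_P_def evolution_algebra_def
proof (intro conjI allI impI)
  fix M assume M: "subalgebra M"
  then have "span (M \<inter> N) \<subseteq> M"
    by (intro span_minimal) (auto simp: subalgebra_def)
  with coordinate[OF M] have "span (M \<inter> N) = M" by blast
  with natural_basis_subset[OF N, of "M \<inter> N"] have "natural_basis M (M \<inter> N)" by simp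
  with N show "\<exists>B. natural_basis M B \<and> (\<exists>B'. B \<subseteq> B' \<and> natural_basis UNIV B')" by blast
qed (use N in blast)

lemma mult_scale_scale: "mult (scale a x) (scale b y) = scale (a * b) (mult x y)"
  using linear_mult_left linear_mult_right by (simp add: Vector_Spaces.linear_iff)

lemma mult_add_left: "mult (x + y) z = mult x z + mult y z"
  using linear_mult_left by (simp add: Vector_Spaces.linear_iff)

lemma mult_add_right: "mult x (y + z) = mult x y + mult x z"
  using linear_mult_right by (simp add: Vector_Spaces.linear_iff)

text \<open>
  If \<open>e\<^sub>1 e\<^sub>1\<close> were a combination of \<open>e\<^sub>1\<close> and \<open>e\<^sub>2\<close> with two nonzero coefficients, its span could
  be a subalgebra containing neither of them. As it is one of the two vectors, a subalgebra that
  contains it can be used to split \<open>a e\<^sub>1 + b e\<^sub>2\<close> into components.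
\<close>

lemma subalgebra_coordinate:
  assumes span: "span {e1, e2} = UNIV"
    and orth: "mult e1 e2 = 0" "mult e2 e1 = 0"
    and squares: "mult e1 e1 \<in> {e1, e2}" "mult e2 e2 = 0"
    and M: "subalgebra M"
  shows "M \<subseteq> span (M \<inter> {e1, e2})"
proof
  fix v assume v: "v \<in> M"
  have M_sub: "subspace M" and vv: "mult v v \<in> M"
    using M v by (auto simp: subalgebra_def)
  have cancel: "x \<in> M" if "scale c x \<in> M" "c \<noteq> 0" for c x
    using subspace_scale[OF M_sub that(1), of "inverse c"] that(2) by simp
  have "v \<in> span {e1, e2}" using span by simp
  then obtain a b where v_eq: "v = scale a e1 + scale b e2"
    by (auto simp: span_insert span_singleton algebra_simps)
  have square: "mult v v = scale (a * a) (mult e1 e1)"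
    by (simp add: v_eq mult_add_left mult_add_right mult_scale_scale orth squares(2))
  have components: "scale a e1 \<in> M \<and> scale b e2 \<in> M"
  proof (cases "a = 0")
    case True
    then show ?thesis using v v_eq subspace_0[OF M_sub] by simp
  next
    case False
    with cancel[of "a * a" "mult e1 e1"] vv square have "mult e1 e1 \<in> M" by simp
    then have "e1 \<in> M \<or> e2 \<in> M" using squares(1) by auto
    then have "scale a e1 \<in> M \<or> scale b e2 \<in> M" using subspace_scale[OF M_sub] by blast
    moreover have "scale b e2 = v - scale a e1" "scale a e1 = v - scale b e2"
      by (simp_all add: v_eq)
    ultimately show ?thesis using subspace_diff[OF M_sub v] by metis
  qed
  have "scale c x \<in> span (M \<inter> {e1, e2})" if "scale c x \<in> M" "x \<in> {e1, e2}" for c x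
  proof (cases "c = 0")
    case True
    then show ?thesis by (simp add: span_zero)
  next
    case False
    with that cancel show ?thesis by (blast intro: span_scale span_base)
  qed
  with components show "v \<in> span (M \<inter> {e1, e2})"
    unfolding v_eq by (simp add: span_add)
qed

end

theorem proposition3p1:
  fixes scale :: "complex \<Rightarrow> 'a::ab_group_add \<Rightarrow> 'a"
    and mult :: "'a \<Rightarrow> 'a \<Rightarrow> 'a"
    and e1 e2 :: 'a
  assumes "fd_complex_algebra scale mult"
    and "e1 \<noteq> e2"
    and "fd_complex_algebra.natural_basis scale mult UNIV {e1, e2}"
  shows "(mult e1 e1 = e1 \<and> mult e2 e2 = 0 \<longrightarrow> fd_complex_algebra.condition_P scale mult) \<and>
    (mult e1 e1 = e2 \<and> mult e2 e2 = 0 \<longrightarrow> fd_complex_algebra.condition_P scale mult)"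
proof -
  interpret fd_complex_algebra scale mult by (rule assms(1))
  have span: "span {e1, e2} = UNIV" and orth: "mult e1 e2 = 0" "mult e2 e1 = 0"
    using assms(2,3) by (auto simp: natural_basis_def pairwise_def)
  have "condition_P" if "mult e1 e1 \<in> {e1, e2}" "mult e2 e2 = 0"
    using condition_P_if_coordinate[OF assms(3)] subalgebra_coordinate[OF span orth that] by blast
  then show ?thesis by simp
qed

end
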